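(* Let $n,m,b,k\in\mathbb{N}$ with $b\geq\max\{2m,4\}$ and $k\ge 1$, and let $w>1$ be a number representable with $n$ bits of which the first $m$ are its integer part. Then the values $\hat{z}_1,\dots,\hat{z}_k$ returned by Algorithm PowerOf2Roots$(w,k,n,m,b)$ (described in the context) satisfy $$\left|\hat{z}_i-w^{1/2^i}\right|\leq 2\left(\frac{3}{4}\right)^{b-2m}\left(2+b+\log_2 b\right),\qquad i=1,2,\dots,k.$$
   Context: Fixed precision representation: a number $w\ge 0$ "given by $n$ bits of which the first $m$ correspond to its integer part" means $w=\sum_{j=m-n}^{m-1} w^{(j)}2^j$ with $w^{(j)}\in\{0,1\}$. For $x\geq 0$, "truncating $x$ to $b$ bits after the binary point" means replacing $x$ by $\lfloor 2^b x\rfloor/2^b$. All arithmetic inside a step is performed exactly; only the stated truncations introduce error. Algorithm SQRT$(w,n,m,b)$ (input $w\geq 1$): if $w=1$, return $1$. Otherwise: let $p\in\mathbb{N}$ with $2^p>w\geq 2^{p-1}$ and set $\hat{x}_0=2^{-p}$; let $s=\lceil\log_2 b\rceil$; for $i=1,\dots,s$ compute exactly $x_i=-w\hat{x}_{i-1}^2+2\hat{x}_{i-1}$ and let $\hat{x}_i$ be $x_i$ truncated to $b$ bits after the binary point. Then let $q\in\mathbb{N}$ with $2^{1-q}>\hat{x}_s\geq 2^{-q}$ and set $\hat{y}_0=2^{\lfloor (q-1)/2\rfloor}$; for $j=1,\dots,s$ compute exactly $y_j=\frac12(3\hat{y}_{j-1}-\hat{x}_s\hat{y}_{j-1}^3)$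 and let $\hat{y}_j$ be $y_j$ truncated to $b$ bits after the binary point. Return $\hat{y}_s$. Algorithm PowerOf2Roots$(w,k,n,m,b)$: set $\hat{z}_1=$ SQRT$(w,n,m,b)$ (a number with $m$ integer bits and $b$ fractional bits); for $i=2,\dots,k$ set $\hat{z}_i=$ SQRT$(\hat{z}_{i-1},m+b,m,b)$. Return $\hat{z}_1,\dots,\hat{z}_k$. *)

theory Defs
  imports Complex_Main
begin

definition fixed_repr :: "nat \<Rightarrow> nat \<Rightarrow> real \<Rightarrow> bool" where
  "fixed_repr n m w \<longleftrightarrow>
     (\<exists>d :: int \<Rightarrow> bool. w = (\<Sum>j\<in>{int m - int n .. int m - 1}. (if d j then 1 else 0) * (2::real) powi j))"

definition trunc_bits :: "nat \<Rightarrow> real \<Rightarrow> real" where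
  "trunc_bits b x = of_int \<lfloor>2 ^ b * x\<rfloor> / 2 ^ b"

definition sqrt_p :: "real \<Rightarrow> nat" where
  "sqrt_p w = (THE p::nat. 2 ^ p > w \<and> w \<ge> (2::real) powr (real p - 1))"

definition sqrt_s :: "nat \<Rightarrow> nat" where
  "sqrt_s b = nat \<lceil>log 2 (real b)\<rceil>"

primrec sqrt_xhat :: "real \<Rightarrow> nat \<Rightarrow> nat \<Rightarrow> real" where
  "sqrt_xhat w b 0 = (2::real) powr (- real (sqrt_p w))"
| "sqrt_xhat w b (Suc i) =
     trunc_bits b (- w * (sqrt_xhat w b i)\<^sup>2 + 2 * sqrt_xhat w b i)"

definition sqrt_q :: "real \<Rightarrow> nat" where
  "sqrt_q x = (THE q::nat. (2::real) powr (1 - real q) > x \<and> x \<ge> (2::real) powr (- real q))"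

primrec sqrt_yhat :: "real \<Rightarrow> nat \<Rightarrow> nat \<Rightarrow> real" where
  "sqrt_yhat xs b 0 = (2::real) powr (real_of_int \<lfloor>(real (sqrt_q xs) - 1) / 2\<rfloor>)"
| "sqrt_yhat xs b (Suc j) =
     trunc_bits b ((3 * sqrt_yhat xs b j - xs * (sqrt_yhat xs b j) ^ 3) / 2)"

text \<open>Algorithm SQRT(w,n,m,b); the parameters n and m only describe the input format.\<close>
definition SQRT :: "real \<Rightarrow> nat \<Rightarrow> nat \<Rightarrow> nat \<Rightarrow> real" where
  "SQRT w n m b =
     (if w = 1 then 1
      else sqrt_yhat (sqrt_xhat w b (sqrt_s b)) b (sqrt_s b))"

text \<open>Algorithm PowerOf2Roots(w,k,n,m,b): \<open>pow2roots w n m b i\<close> is \<open>z\<^sub>i\<close> for \<open>i \<ge> 1\<close>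
  (value at index 0 is irrelevant and set to w).\<close>
fun pow2roots :: "real \<Rightarrow> nat \<Rightarrow> nat \<Rightarrow> nat \<Rightarrow> nat \<Rightarrow> real" where
  "pow2roots w n m b 0 = w"
| "pow2roots w n m b (Suc 0) = SQRT w n m b"
| "pow2roots w n m b (Suc (Suc i)) = SQRT (pow2roots w n m b (Suc i)) (m + b) m b"

end

(*
  Both inner loops are Newton iterations that approach their limits monotonically from below, and
  truncation preserves this because the starting points lie on the grid of multiples of 2^-b.
  The relative errors d = 1 - w x and e = 1 - y sqrt x satisfy d' = d^2 and e' = e^2 (3 - e) / 2,
  so they decay like (1/2)^(2^i) and (2/3) (3/4)^(2^i); both maps are nonexpansive in the relevant
  range, hence the truncations contribute only s 2^-b.  Finally, all values stay above 1, where
  sqrt contracts by 1/2, so the errors of the successive roots sum to at most twice the error of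
  one call.
*)
theory Submission
  imports Defs
begin

section \<open>Truncation and initial values\<close>

lemma trunc_bits_le: "trunc_bits b x \<le> x"
  unfolding trunc_bits_def by (simp add: field_simps)

lemma trunc_bits_ge: "x - 1 / 2 ^ b \<le> trunc_bits b x"
proof -
  have "(2 ^ b * x - 1) / 2 ^ b \<le> of_int \<lfloor>2 ^ b * x\<rfloor> / 2 ^ b"
    by (intro divide_right_mono) (linarith, simp)
  then show ?thesis
    by (simp add: trunc_bits_def diff_divide_distrib)
qed

lemma trunc_bits_grid: "2 ^ b * trunc_bits b x \<in> \<int>"
  by (simp add: trunc_bits_def)

text \<open>Truncation picks the largest multiple of 2^-b below its argument, so it cannot pass
  below a grid point. Applied with \<open>c\<close> the previous iterate, this keeps both truncated
  iterations nondecreasing.\<close>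

lemma grid_le_trunc_bits:
  assumes "2 ^ b * c \<in> \<int>" "c \<le> x"
  shows "c \<le> trunc_bits b x"
proof -
  obtain k where k: "2 ^ b * c = of_int k"
    using assms(1) by (auto elim: Ints_cases)
  have "of_int k \<le> 2 ^ b * x"
    using assms(2) unfolding k[symmetric] by (intro mult_left_mono) auto
  then have "k \<le> \<lfloor>2 ^ b * x\<rfloor>"
    by (simp add: le_floor_iff)
  then have "2 ^ b * c \<le> of_int \<lfloor>2 ^ b * x\<rfloor>"
    unfolding k by simp
  then show ?thesis
    unfolding trunc_bits_def by (simp add: field_simps)
qed

text \<open>After taking logarithms the two conditions determine p as floor(log 2 w) + 1, so the
  definite description is well defined. The second bound makes the initial relative error 1 - w /
  2^p at most 1/2.\<close>

lemma sqrt_p_bounds: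
  assumes "w \<ge> 1"
  shows "w < 2 ^ sqrt_p w" "2 ^ sqrt_p w \<le> 2 * w"
proof -
  let ?P = "\<lambda>p::nat. 2 ^ p > w \<and> w \<ge> (2::real) powr (real p - 1)"
  define l where "l = log 2 w"
  have l0: "l \<ge> 0" and w: "w = 2 powr l"
    using assms by (auto simp: l_def)
  have P_iff: "?P p \<longleftrightarrow> l < real p \<and> real p - 1 \<le> l" for p
    unfolding w powr_realpow[symmetric, OF zero_less_numeral] by simp
  have "\<exists>!p. ?P p"
    unfolding P_iff
  proof (rule ex1I[of _ "nat \<lfloor>l\<rfloor> + 1"])
    show "l < real (nat \<lfloor>l\<rfloor> + 1) \<and> real (nat \<lfloor>l\<rfloor> + 1) - 1 \<le> l"
      using l0 by (simp add: of_nat_nat) linarith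
    show "p = nat \<lfloor>l\<rfloor> + 1" if "l < real p \<and> real p - 1 \<le> l" for p
      using that l0 by linarith
  qed
  then have "?P (sqrt_p w)"
    unfolding sqrt_p_def by (rule theI')
  then show "w < 2 ^ sqrt_p w" "2 ^ sqrt_p w \<le> 2 * w"
    by (auto simp: powr_diff powr_realpow field_simps)
qed

text \<open>Here the conditions determine q as the ceiling of -log 2 x. It is positive because x <
  1, which keeps the exponent of the starting value of the second iteration nonnegative.\<close>

lemma sqrt_q_bounds:
  assumes "0 < x" "x < 1"
  shows "x < 2 powr (1 - real (sqrt_q x))" "2 powr (- real (sqrt_q x)) \<le> x"
    "sqrt_q x \<ge> 1"
proof -
  let ?P = "\<lambda>q::nat. (2::real) powr (1 - real q) > x \<and> x \<ge> (2::real) powr (- real q)"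
  define l where "l = log 2 x"
  have l0: "l < 0" and x: "x = 2 powr l"
    using assms by (auto simp: l_def)
  have P_iff: "?P q \<longleftrightarrow> l < 1 - real q \<and> - real q \<le> l" for q
    unfolding x by simp
  have "\<exists>!q. ?P q"
    unfolding P_iff
  proof (rule ex1I[of _ "nat \<lceil>- l\<rceil>"])
    show "l < 1 - real (nat \<lceil>- l\<rceil>) \<and> - real (nat \<lceil>- l\<rceil>) \<le> l"
      using l0 by linarith
    show "q = nat \<lceil>- l\<rceil>" if "l < 1 - real q \<and> - real q \<le> l" for q
      using that l0 by linarith
  qed
  then have "?P (sqrt_q x)"
    unfolding sqrt_q_def by (rule theI')
  then show "x < 2 powr (1 - real (sqrt_q x))" "2 powr (- real (sqrt_q x)) \<le> x"
    "sqrt_q x \<ge> 1"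
    using P_iff l0 by auto
qed

text \<open>The first bound turns the decay c^(2^s) of \<open>s\<close> quadratically convergent
  steps into c^b; the second bounds the number of truncations.\<close>

lemma sqrt_s_bounds:
  assumes "b \<ge> 1"
  shows "b \<le> 2 ^ sqrt_s b" "real (sqrt_s b) \<le> 1 + log 2 (real b)"
proof -
  have l: "log 2 (real b) \<ge> 0"
    using assms by simp
  then show "real (sqrt_s b) \<le> 1 + log 2 (real b)"
    unfolding sqrt_s_def by linarith
  have "log 2 (real b) \<le> real (sqrt_s b)"
    unfolding sqrt_s_def by linarith
  then have "2 powr log 2 (real b) \<le> 2 powr real (sqrt_s b)"
    by simp
  then have "real b \<le> 2 ^ sqrt_s b"
    using assms by (simp add: powr_realpow)
  then show "b \<le> 2 ^ sqrt_s b"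
    by (metis of_nat_le_iff of_nat_numeral of_nat_power)
qed

section \<open>The reciprocal iteration\<close>

text \<open>The grid condition, which holds initially since \<open>sqrt_p w \<le> b\<close>, gives
  monotonicity under truncation; the lower bound keeps the relative error at most 1/2. A truncation
  lowers x by at most 2^-b and so adds at most w / 2^b to the relative error, while the exact step
  squares it.\<close>

lemma sqrt_xhat_invariant:
  assumes w: "w \<ge> 1" and p: "sqrt_p w \<le> b"
  shows "2 ^ b * sqrt_xhat w b i \<in> \<int> \<and> 1 / 2 ^ sqrt_p w \<le> sqrt_xhat w b i \<and>
    w * sqrt_xhat w b i \<le> 1 \<and>
    1 - w * sqrt_xhat w b i \<le> (1 / 2) ^ 2 ^ i + real i * (w / 2 ^ b)"
proof (induction i)
  case 0
  have x0: "sqrt_xhat w b 0 = 1 / 2 ^ sqrt_p w"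
    by (simp add: powr_minus powr_realpow field_simps)
  have "(2::real) ^ b * (1 / 2 ^ sqrt_p w) = 2 ^ (b - sqrt_p w)"
    using p by (simp add: power_diff)
  then have "2 ^ b * (1 / 2 ^ sqrt_p w :: real) \<in> \<int>"
    by simp
  then show ?case
    unfolding x0 using sqrt_p_bounds[OF w] by (auto simp: field_simps)
next
  case (Suc i)
  define x where "x = sqrt_xhat w b i"
  define y where "y = - w * x\<^sup>2 + 2 * x"
  define d where "d = 1 - w * x"
  define a :: real where "a = (1 / 2) ^ 2 ^ i"
  have IH: "2 ^ b * x \<in> \<int>" "1 / 2 ^ sqrt_p w \<le> x" "w * x \<le> 1"
    "d \<le> a + real i * (w / 2 ^ b)"
    using Suc.IH by (auto simp: x_def d_def a_def)
  have step: "sqrt_xhat w b (Suc i) = trunc_bits b y"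
    by (simp add: x_def y_def)
  have x: "x > 0"
    using IH(2) by (rule less_le_trans[rotated]) simp
  have wy: "1 - w * y = d\<^sup>2"
    unfolding y_def d_def by (simp add: power2_eq_square algebra_simps)
  have "y - x = x * d"
    unfolding y_def d_def by (simp add: power2_eq_square algebra_simps)
  moreover have d0: "d \<ge> 0"
    using IH(3) by (simp add: d_def)
  ultimately have xy: "x \<le> y"
    using x by (smt (verit) mult_nonneg_nonneg)
  have "w * (1 / 2 ^ sqrt_p w) \<le> w * x"
    using mult_left_mono[OF IH(2), of w] w by linarith
  moreover have "w * (1 / 2 ^ sqrt_p w) \<ge> 1 / 2"
    using sqrt_p_bounds(2)[OF w] by (simp add: field_simps)
  ultimately have d1: "d \<le> 1 / 2"
    unfolding d_def by linarith
  have a: "0 \<le> a" "a \<le> 1 / 2"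
    using power_decreasing[of 1 "2 ^ i" "1 / 2 :: real"] by (auto simp: a_def)
  have "d\<^sup>2 \<le> a\<^sup>2 + real i * (w / 2 ^ b)"
  proof (cases "d \<le> a")
    case True
    then have "d\<^sup>2 \<le> a\<^sup>2"
      using d0 by (intro power_mono)
    then show ?thesis
      using w by (simp add: add_increasing2)
  next
    \<comment> \<open>Squaring is nonexpansive on [0, 1/2] because d + a <= 1, so earlier truncation
      errors are not amplified.\<close>
    case False
    have "d\<^sup>2 - a\<^sup>2 = (d - a) * (d + a)"
      by (simp add: power2_eq_square algebra_simps)
    also have "\<dots> \<le> (d - a) * 1"
      using False d1 a by (intro mult_left_mono) auto
    finally show ?thesis
      using IH(4) by simp
  qed
  moreover have "a\<^sup>2 = (1 / 2) ^ 2 ^ Suc i"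
    by (simp add: a_def power_mult[symmetric] mult.commute)
  moreover have "w * (y - 1 / 2 ^ b) \<le> w * trunc_bits b y"
    using trunc_bits_ge w by (intro mult_left_mono) auto
  ultimately have "1 - w * trunc_bits b y \<le> (1 / 2) ^ 2 ^ Suc i + real (Suc i) * (w / 2 ^ b)"
    using wy by (simp add: algebra_simps add_divide_distrib)
  moreover have "w * trunc_bits b y \<le> w * y"
    using trunc_bits_le w by (intro mult_left_mono) auto
  then have "w * trunc_bits b y \<le> 1"
    using wy zero_le_power2[of d] by linarith
  moreover have "1 / 2 ^ sqrt_p w \<le> trunc_bits b y"
    using grid_le_trunc_bits[OF IH(1) xy] IH(2) by linarith
  ultimately show ?case
    unfolding step using trunc_bits_grid by blast
qed

section \<open>The inverse square root iteration\<close>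

text \<open>The relative error after an exact step from y = (1 - e) / sqrt x.\<close>

definition newton_err :: "real \<Rightarrow> real" where
  "newton_err e = e\<^sup>2 * (3 - e) / 2"

lemma newton_err_diff:
  "newton_err e - newton_err a = (e - a) * ((3 * (e + a) - (e\<^sup>2 + e * a + a\<^sup>2)) / 2)"
  unfolding newton_err_def by (simp add: power2_eq_square field_simps)

lemma newton_err_mono:
  assumes "0 \<le> e" "e \<le> a" "a \<le> 1"
  shows "newton_err e \<le> newton_err a"
proof -
  have "a\<^sup>2 \<le> a" "a * e \<le> e" "e\<^sup>2 \<le> e"
    using assms mult_right_mono[of a 1 a] mult_right_mono[of a 1 e] mult_right_mono[of e 1 e]
    by (auto simp: power2_eq_square)
  then have "0 \<le> (a - e) * ((3 * (a + e) - (a\<^sup>2 + a * e + e\<^sup>2)) / 2)"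
    using assms by (intro mult_nonneg_nonneg) auto
  then show ?thesis
    unfolding newton_err_diff[of a e, symmetric] by simp
qed

text \<open>The derivative \<open>3 e - 3 e\<^sup>2 / 2\<close> exceeds 1 at \<open>e = 1 / 2\<close>,
  so nonexpansiveness is only available after the first step.\<close>

lemma newton_err_nonexpansive:
  assumes "0 \<le> a" "a \<le> e" "e \<le> 3 / 8"
  shows "newton_err e - newton_err a \<le> e - a"
proof -
  \<comment> \<open>These two facts give e^2 + e a + a^2 >= 3 e a >= 9/8 (e + a) - 27/64. With e + a
    <= 3/4 the left side of the next inequality is at most 117/64 < 2.\<close>
  have "0 \<le> (3 / 8 - e) * (3 / 8 - a)" "0 \<le> (e - a)\<^sup>2"
    using assms by auto
  then have "3 * (e + a) - (e\<^sup>2 + e * a + a\<^sup>2) \<le> 2"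
    using assms by (simp add: power2_eq_square algebra_simps)
  then have "(e - a) * ((3 * (e + a) - (e\<^sup>2 + e * a + a\<^sup>2)) / 2) \<le> (e - a) * 1"
    using assms by (intro mult_left_mono) auto
  then show ?thesis
    unfolding newton_err_diff by simp
qed

lemma newton_err_le: "0 \<le> e \<Longrightarrow> newton_err e \<le> 3 / 2 * e\<^sup>2"
  unfolding newton_err_def by (simp add: field_simps)

text \<open>The starting value is 2^r with q - 2 <= 2 r <= q - 1. Hence the square of y sqrt x,
  which is 2^(2 r) x, lies between 2^(q-2) 2^-q = 1/4 and 2^(q-1) 2^(1-q) = 1.\<close>

lemma sqrt_yhat_0_bounds:
  assumes x: "0 < x" "x < 1"
  shows "2 ^ b * sqrt_yhat x b 0 \<in> \<int>" "1 \<le> sqrt_yhat x b 0"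
    "1 / 2 \<le> sqrt_yhat x b 0 * sqrt x" "sqrt_yhat x b 0 * sqrt x \<le> 1"
proof -
  define q where "q = sqrt_q x"
  define r where "r = nat \<lfloor>(real q - 1) / 2\<rfloor>"
  have q: "x < 2 powr (1 - real q)" "2 powr (- real q) \<le> x" "q \<ge> 1"
    using sqrt_q_bounds[OF x] by (auto simp: q_def)
  have "\<lfloor>(real q - 1) / 2\<rfloor> = int r" and r: "2 * real r \<le> real q - 1" "real q - 2 \<le> 2 * real r"
  proof -
    have "0 \<le> (real q - 1) / 2"
      using q(3) by simp
    then show r_eq: "\<lfloor>(real q - 1) / 2\<rfloor> = int r"
      by (simp add: r_def)
    have "real r \<le> (real q - 1) / 2" "(real q - 1) / 2 < real r + 1"
      using floor_eq_iff[THEN iffD1, OF r_eq] by simp_all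
    then show "2 * real r \<le> real q - 1"
      by simp
    \<comment> \<open>Integrality sharpens q < 2 r + 3 to q <= 2 r + 2; the real inequality alone
      would give 1/8 in place of 1/4.\<close>
    have "real q < real (2 * r + 3)"
      using \<open>(real q - 1) / 2 < real r + 1\<close> by simp
    then have "q \<le> 2 * r + 2"
      unfolding of_nat_less_iff by simp
    then have "real q \<le> real (2 * r + 2)"
      unfolding of_nat_le_iff .
    then show "real q - 2 \<le> 2 * real r"
      by simp
  qed
  then have y0: "sqrt_yhat x b 0 = 2 ^ r"
    by (simp add: q_def powr_realpow)
  show "2 ^ b * sqrt_yhat x b 0 \<in> \<int>" "1 \<le> sqrt_yhat x b 0"
    unfolding y0 by (auto simp del: sqrt_yhat.simps)
  have sq: "(2 ^ r * sqrt x)\<^sup>2 = 2 powr (2 * real r) * x"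
    using x by (simp add: power_mult_distrib powr_realpow[symmetric] powr_powr flip: powr_numeral)
      (simp add: mult.commute)
  have "2 powr (2 * real r) * x \<le> 2 powr (real q - 1) * 2 powr (1 - real q)"
    using q r x by (intro mult_mono) auto
  then have "(2 ^ r * sqrt x)\<^sup>2 \<le> 1\<^sup>2"
    unfolding sq by (simp flip: powr_add)
  then show "sqrt_yhat x b 0 * sqrt x \<le> 1"
    unfolding y0 by (rule power2_le_imp_le) simp
  have "2 powr (real q - 2) * 2 powr (- real q) \<le> 2 powr (2 * real r) * x"
    using q r x by (intro mult_mono) auto
  moreover have "(1 / 2)\<^sup>2 = (2::real) powr (real q - 2) * 2 powr (- real q)"
    unfolding powr_add[symmetric] by (simp add: powr_minus power2_eq_square)
  ultimately have "(1 / 2)\<^sup>2 \<le> (2 ^ r * sqrt x)\<^sup>2"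
    unfolding sq by linarith
  then show "1 / 2 \<le> sqrt_yhat x b 0 * sqrt x"
    unfolding y0 by (rule power2_le_imp_le) (use x in simp)
qed

text \<open>An exact step sends e to at most 3/2 e^2, so 3/2 e is at most squared; it starts at most
  at 3/2 * 1/2 = 3/4, whence the main term. The bound 3/8 from the first step on is what
  \<open>newton_err_nonexpansive\<close> requires to carry the truncation errors along
  unamplified.\<close>

lemma sqrt_yhat_invariant:
  assumes x: "0 < x" "x < 1" and b: "b \<ge> 4"
  shows "2 ^ b * sqrt_yhat x b j \<in> \<int> \<and> 1 \<le> sqrt_yhat x b j \<and>
    0 \<le> 1 - sqrt_yhat x b j * sqrt x \<and>
    1 - sqrt_yhat x b j * sqrt x \<le> (if j = 0 then 1 / 2 else 3 / 8) \<and>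
    1 - sqrt_yhat x b j * sqrt x \<le> 2 / 3 * (3 / 4) ^ 2 ^ j + real j * (sqrt x / 2 ^ b)"
proof (induction j)
  case 0
  show ?case
    using sqrt_yhat_0_bounds[OF x, of b] by simp
next
  case (Suc j)
  define y where "y = sqrt_yhat x b j"
  define z where "z = (3 * y - x * y ^ 3) / 2"
  define t where "t = trunc_bits b z"
  define e where "e = 1 - y * sqrt x"
  define a :: real where "a = 2 / 3 * (3 / 4) ^ 2 ^ j"
  define \<tau> where "\<tau> = sqrt x / 2 ^ b"
  have IH: "2 ^ b * y \<in> \<int>" "1 \<le> y" "0 \<le> e" "e \<le> (if j = 0 then 1 / 2 else 3 / 8)"
    "e \<le> a + real j * \<tau>"
    using Suc.IH by (auto simp: y_def e_def a_def \<tau>_def)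
  have step: "sqrt_yhat x b (Suc j) = t"
    by (simp add: y_def z_def t_def)
  have e1: "e \<le> 1 / 2"
    using IH(4) by (simp split: if_splits)
  have u: "0 < sqrt x" "sqrt x \<le> 1" "sqrt x * sqrt x = x"
    using x by auto
  have zu: "1 - z * sqrt x = newton_err e"
  proof -
    have "z * sqrt x = (3 * (y * sqrt x) - (y * sqrt x) ^ 3) / 2"
      unfolding z_def using u(3) by (simp add: power3_eq_cube algebra_simps)
    also have "y * sqrt x = 1 - e"
      by (simp add: e_def)
    finally show ?thesis
      unfolding newton_err_def by (simp add: power2_eq_square power3_eq_cube algebra_simps)
  qed
  have "z - y = y * (1 - (y * sqrt x)\<^sup>2) / 2"
    unfolding z_def using x by (simp add: power_mult_distrib power2_eq_square power3_eq_cube field_simps)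
  moreover have "0 \<le> y * (1 - (y * sqrt x)\<^sup>2) / 2"
  proof -
    have "(y * sqrt x)\<^sup>2 \<le> 1"
      using IH(2,3) u by (intro power_le_one) (auto simp: e_def)
    then show ?thesis
      using IH(2) by simp
  qed
  ultimately have "y \<le> z"
    by linarith
  then have yt: "y \<le> t"
    unfolding t_def by (rule grid_le_trunc_bits[OF IH(1)])
  have "t * sqrt x \<le> z * sqrt x"
    unfolding t_def using trunc_bits_le u by (intro mult_right_mono) auto
  moreover have "newton_err e \<ge> 0"
    unfolding newton_err_def using e1 by simp
  ultimately have t0: "0 \<le> 1 - t * sqrt x"
    using zu by linarith
  have "(z - 1 / 2 ^ b) * sqrt x \<le> t * sqrt x"
    unfolding t_def using trunc_bits_ge u by (intro mult_right_mono) auto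
  then have te: "1 - t * sqrt x \<le> newton_err e + \<tau>"
    using zu by (simp add: \<tau>_def algebra_simps)
  have \<tau>: "0 \<le> \<tau>" "\<tau> \<le> 1 / 16"
  proof -
    have "(2::real) ^ 4 \<le> 2 ^ b"
      using b by (intro power_increasing) auto
    then have "sqrt x / 2 ^ b \<le> 1 / 2 ^ 4"
      using u by (intro frac_le) auto
    then show "0 \<le> \<tau>" "\<tau> \<le> 1 / 16"
      using u by (auto simp: \<tau>_def)
  qed
  have t1: "1 - t * sqrt x \<le> 3 / 8"
  proof (cases "j = 0")
    case True
    \<comment> \<open>The first step leaves 5/16, and its truncation adds at most 1/16 since b >= 4;
      together this is exactly 3/8.\<close>
    have "newton_err e \<le> newton_err (1 / 2)"
      using IH(3) e1 by (intro newton_err_mono) auto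
    also have "\<dots> = 5 / 16"
      by (simp add: newton_err_def power2_eq_square)
    finally show ?thesis
      using te \<tau> by linarith
  next
    case False
    \<comment> \<open>The iterates do not decrease, so the bound 3/8 persists.\<close>
    have "y * sqrt x \<le> t * sqrt x"
      using yt u by (intro mult_right_mono) auto
    then show ?thesis
      using IH(4) False by (simp add: e_def)
  qed
  have a0: "0 \<le> a" "a \<le> 1 / 2"
    using power_decreasing[of 1 "2 ^ j" "3 / 4 :: real"] by (auto simp: a_def)
  have "newton_err e \<le> newton_err a + real j * \<tau>"
  proof (cases "e \<le> a")
    case True
    then have "newton_err e \<le> newton_err a"
      using IH(3) a0 by (intro newton_err_mono) auto
    then show ?thesis
      using \<tau>(1) by (simp add: add_increasing2)
  next
    case False
    \<comment> \<open>Before any truncation the bound reads e <= a, so the initial error, possibly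
      outside the nonexpansive range, never reaches this case.\<close>
    then have "j \<noteq> 0"
      using IH(5) by (intro notI) simp
    then have "newton_err e - newton_err a \<le> e - a"
      using False IH(4) a0 by (intro newton_err_nonexpansive) auto
    then show ?thesis
      using IH(5) by linarith
  qed
  also have "newton_err a \<le> 3 / 2 * a\<^sup>2"
    by (rule newton_err_le[OF a0(1)])
  also have "3 / 2 * a\<^sup>2 = 2 / 3 * (3 / 4) ^ 2 ^ Suc j"
    unfolding a_def power_mult_distrib power_Suc power_even_eq by (simp add: power_divide)
  finally have "1 - t * sqrt x \<le> 2 / 3 * (3 / 4) ^ 2 ^ Suc j + real (Suc j) * \<tau>"
    using te by (simp add: algebra_simps)
  moreover have "1 \<le> t" "2 ^ b * t \<in> \<int>"
    using IH(2) yt by (auto simp: t_def trunc_bits_grid)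
  ultimately show ?case
    unfolding step using t0 t1 by (simp add: \<tau>_def)
qed

section \<open>Error of one square root\<close>

text \<open>Compare both y and sqrt w with v = 1 / sqrt x, where x is the computed reciprocal. Both
  lie below v, so the error is at most the larger of v - y and v - sqrt w. The range bounds allow
  the result to be the input of the next call.\<close>

lemma SQRT_bounds:
  assumes w: "1 \<le> w" "w < 2 ^ m" and b: "b \<ge> 2 * m" "b \<ge> 4"
  shows "1 \<le> SQRT w n m b" "SQRT w n m b < 2 ^ m"
    "\<bar>SQRT w n m b - sqrt w\<bar> \<le> (3 / 4) ^ (b - 2 * m) * (2 + real b + log 2 (real b))"
proof -
  let ?G = "(3 / 4 :: real) ^ (b - 2 * m)"
  have "1 \<le> SQRT w n m b \<and> SQRT w n m b < 2 ^ m \<and>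
    \<bar>SQRT w n m b - sqrt w\<bar> \<le> ?G * (2 + real b + log 2 (real b))"
  proof (cases "w = 1")
    case True
    have "0 \<le> log 2 (real b)"
      using b by simp
    then have "0 \<le> ?G * (2 + real b + log 2 (real b))"
      by (intro mult_nonneg_nonneg) auto
    then show ?thesis
      using True w by (simp add: SQRT_def)
  next
    case False
    then have w1: "1 < w"
      using w by simp
    define s where "s = sqrt_s b"
    define x where "x = sqrt_xhat w b s"
    define y where "y = sqrt_yhat x b s"
    have S: "SQRT w n m b = y"
      using False by (simp add: SQRT_def s_def x_def y_def)
    have s: "b \<le> 2 ^ s" "real s \<le> 1 + log 2 (real b)"
      using sqrt_s_bounds[of b] b by (auto simp: s_def)
    \<comment> \<open>The strict bound w < 2^m yields p <= m rather than p <= m + 1.\<close>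
    have "(2::real) ^ sqrt_p w < 2 ^ Suc m"
      using sqrt_p_bounds(2)[OF w(1)] w(2) by simp
    then have pm: "sqrt_p w \<le> m"
      by (simp add: power_less_imp_less_exp less_Suc_eq_le[symmetric] del: power_Suc)
    then have pb: "sqrt_p w \<le> b"
      using b by simp
    have xinv: "1 / 2 ^ sqrt_p w \<le> x" "w * x \<le> 1"
      "1 - w * x \<le> (1 / 2) ^ 2 ^ s + real s * (w / 2 ^ b)"
      using sqrt_xhat_invariant[OF w(1) pb, of s] by (auto simp: x_def)
    have x0: "0 < x"
      using xinv(1) by (rule less_le_trans[rotated]) simp
    \<comment> \<open>Strictness comes from w > 1; it meets the premise of the second
      iteration.\<close>
    have x1: "x < 1"
    proof -
      have "1 * x < w * x"
        using w1 x0 by (intro mult_strict_right_mono)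
      then show ?thesis
        using xinv(2) by linarith
    qed
    have xm: "1 \<le> 2 ^ m * x"
    proof -
      have "1 \<le> 2 ^ sqrt_p w * x"
        using xinv(1) by (simp add: field_simps)
      also have "\<dots> \<le> 2 ^ m * x"
        using pm x0 by (intro mult_right_mono power_increasing) auto
      finally show ?thesis .
    qed
    have m1: "1 \<le> m"
      using w w1 by (cases m) auto
    have wx: "1 \<le> 2 * (w * x)"
    proof -
      have "1 \<le> 2 ^ sqrt_p w * x"
        using xinv(1) by (simp add: field_simps)
      also have "\<dots> \<le> 2 * w * x"
        using sqrt_p_bounds(2)[OF w(1)] x0 by (intro mult_right_mono) auto
      finally show ?thesis
        by simp
    qed
    define v where "v = 1 / sqrt x"
    have v: "v > 0" "v * sqrt x = 1" "v\<^sup>2 = 1 / x"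
      using x0 by (auto simp: v_def power_divide)
    have yinv: "1 \<le> y" "0 \<le> 1 - y * sqrt x"
      "1 - y * sqrt x \<le> 2 / 3 * (3 / 4) ^ 2 ^ s + real s * (sqrt x / 2 ^ b)"
      using sqrt_yhat_invariant[OF x0 x1 b(2), of s] by (auto simp: y_def)
    have vy: "v - y = v * (1 - y * sqrt x)"
      using v(2) by (simp add: algebra_simps)
    have yv: "y \<le> v"
      using vy v(1) yinv(2) by (smt (verit) mult_nonneg_nonneg)
    have v2m: "v\<^sup>2 \<le> 2 ^ m"
      unfolding v(3) using xm x0 by (simp add: field_simps)
    have "v < 2 ^ m"
    proof (rule power2_less_imp_less)
      have "(2::real) ^ m < 2 ^ (m * 2)"
        using m1 by (intro power_strict_increasing) auto
      then show "v\<^sup>2 < (2 ^ m)\<^sup>2"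
        using v2m by (simp add: power_mult)
    qed simp
    then have y2m: "y < 2 ^ m"
      using yv by simp
    \<comment> \<open>The base 16/9 = (4/3)^2 is chosen so that its m-th power times (3/4)^b is
      exactly (3/4)^(b - 2m); it suffices since v^2 <= 2^m.\<close>
    have v169: "v \<le> (16 / 9) ^ m"
    proof (rule power2_le_imp_le)
      have "(2::real) ^ m \<le> ((16 / 9)\<^sup>2) ^ m"
        by (intro power_mono) (auto simp: power2_eq_square)
      then show "v\<^sup>2 \<le> ((16 / 9) ^ m)\<^sup>2"
        using v2m by (simp add: power_mult[symmetric] mult.commute)
    qed simp
    have G: "(3 / 4) ^ b * (16 / 9) ^ m = ?G" "4 ^ m / 2 ^ b \<le> ?G"
    proof -
      \<comment> \<open>By b >= 2m the natural-number subtraction is not cut off at 0.\<close>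
      have bsplit: "b = (b - 2 * m) + 2 * m"
        using b by simp
      have "(3 / 4 :: real) ^ b = ?G * (9 / 16) ^ m"
        by (subst bsplit, subst power_add, subst power_mult) (simp add: power2_eq_square)
      then show "(3 / 4) ^ b * (16 / 9) ^ m = ?G"
        by (simp add: power_mult_distrib[symmetric] mult.assoc)
      have "(2::real) ^ b = 2 ^ (b - 2 * m) * 4 ^ m"
        by (subst bsplit, subst power_add, subst power_mult) simp
      then have "4 ^ m / 2 ^ b = (1 / 2 :: real) ^ (b - 2 * m)"
        by (simp add: power_one_over)
      also have "\<dots> \<le> ?G"
        by (intro power_mono) auto
      finally show "4 ^ m / 2 ^ b \<le> ?G" .
    qed
    have b4: "1 / 2 ^ b \<le> 4 ^ m / (2 ^ b :: real)"
      by (intro divide_right_mono) auto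
    have err_y: "v - y \<le> ?G * (1 + real s)"
    proof -
      have "v - y \<le> v * (2 / 3 * (3 / 4) ^ 2 ^ s + real s * (sqrt x / 2 ^ b))"
        unfolding vy using v yinv by (intro mult_left_mono) auto
      \<comment> \<open>Since v sqrt x = 1, each truncation contributes exactly 2^-b to this
        absolute error bound.\<close>
      also have "\<dots> = v * (2 / 3 * (3 / 4) ^ 2 ^ s) + real s * (1 / 2 ^ b)"
        using v(2) by (simp add: algebra_simps)
      also have "v * (2 / 3 * (3 / 4) ^ 2 ^ s) \<le> (16 / 9) ^ m * (1 * (3 / 4) ^ b)"
        using v169 v s by (intro mult_mono power_decreasing) auto
      also have "\<dots> = ?G"
        using G(1) by (simp add: mult.commute)
      also have "real s * (1 / 2 ^ b) \<le> real s * ?G"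
        using G(2) b4 by (intro mult_left_mono) auto
      finally show ?thesis
        by (simp add: algebra_simps)
    qed
    define r where "r = sqrt w"
    have r: "1 \<le> r" "r * r = w" "r \<le> w"
    proof -
      show "1 \<le> r" "r * r = w"
        using w by (auto simp: r_def)
      then show "r \<le> w"
        by (metis mult_le_cancel_left1 not_le order_trans zero_le_one)
    qed
    have rv: "r \<le> v"
    proof (rule power2_le_imp_le)
      have "w \<le> v\<^sup>2"
        unfolding v(3) using xinv(2) x0 by (simp add: field_simps)
      then show "r\<^sup>2 \<le> v\<^sup>2"
        using r(2) by (simp add: power2_eq_square)
    qed (use v in simp)
    have err_x: "v - r \<le> ?G * (1 + real s)"
    proof -
      \<comment> \<open>Divide v^2 - w = (1 - w x) / x by v + r >= 2 r. As 1 / x <= 2 w = 2 r^2,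
        this leaves v - r <= (1 - w x) r.\<close>
      have "(v - r) * (2 * r) \<le> (v - r) * (v + r)"
        using rv by (intro mult_left_mono) auto
      also have "\<dots> = v\<^sup>2 - w"
        using r by (simp add: power2_eq_square algebra_simps)
      also have "\<dots> = (1 - w * x) / x"
        using v(3) x0 by (simp add: field_simps)
      also have "\<dots> \<le> (1 - w * x) * (2 * w)"
      proof -
        have "1 / x \<le> 2 * w"
          using wx x0 by (simp add: field_simps)
        then have "(1 - w * x) * (1 / x) \<le> (1 - w * x) * (2 * w)"
          using xinv(2) by (intro mult_left_mono) auto
        then show ?thesis
          by simp
      qed
      also have "\<dots> = (1 - w * x) * r * (2 * r)"
        unfolding r(2)[symmetric] by (simp add: ac_simps)
      finally have "v - r \<le> (1 - w * x) * r"
        using r(1) by simp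
      \<comment> \<open>One factor w bounds r and the other comes from the truncation term; their
        product is below 4^m, which 2^b absorbs up to (1/2)^(b - 2m).\<close>
      also have "\<dots> \<le> (w * ((1 + real s) / 2 ^ b)) * w"
      proof (intro mult_mono)
        have "(1 / 2 :: real) ^ 2 ^ s \<le> (1 / 2) ^ b"
          using s by (intro power_decreasing) auto
        also have "\<dots> = 1 * (1 / 2 ^ b)"
          by (simp add: power_one_over)
        also have "\<dots> \<le> w * (1 / 2 ^ b)"
          using w by (intro mult_right_mono) auto
        finally show "1 - w * x \<le> w * ((1 + real s) / 2 ^ b)"
          using xinv(3) by (simp add: algebra_simps add_divide_distrib)
      qed (use r w in auto)
      also have "\<dots> = w\<^sup>2 * ((1 + real s) / 2 ^ b)"
        by (simp add: power2_eq_square)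
      also have "\<dots> \<le> (2 ^ m)\<^sup>2 * ((1 + real s) / 2 ^ b)"
        using w by (intro mult_right_mono power_mono) auto
      also have "(2 ^ m)\<^sup>2 = (4::real) ^ m"
        by (simp add: power2_eq_square power_mult_distrib[symmetric])
      also have "4 ^ m * ((1 + real s) / 2 ^ b) = 4 ^ m / 2 ^ b * (1 + real s)"
        by simp
      also have "\<dots> \<le> ?G * (1 + real s)"
        using G(2) by (intro mult_right_mono) auto
      finally show ?thesis .
    qed
    have "1 + real s \<le> 2 + real b + log 2 (real b)"
      using s(2) b by simp
    then have "?G * (1 + real s) \<le> ?G * (2 + real b + log 2 (real b))"
      by (intro mult_left_mono) auto
    then have "\<bar>y - r\<bar> \<le> ?G * (2 + real b + log 2 (real b))"
      using err_x err_y rv yv by linarith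
    then show ?thesis
      unfolding S using yinv(1) y2m by (simp add: r_def)
  qed
  then show "1 \<le> SQRT w n m b" "SQRT w n m b < 2 ^ m"
    "\<bar>SQRT w n m b - sqrt w\<bar> \<le> ?G * (2 + real b + log 2 (real b))"
    by auto
qed

section \<open>Accumulated error\<close>

text \<open>Setting all digits to one gives the geometric sum 2^m - 2^(m - n).\<close>

lemma fixed_repr_less:
  assumes "fixed_repr n m w"
  shows "w < 2 ^ m"
proof -
  obtain d :: "int \<Rightarrow> bool" where
    d: "w = (\<Sum>j\<in>{int m - int n..int m - 1}. (if d j then 1 else 0) * (2::real) powi j)"
    using assms by (auto simp: fixed_repr_def)
  have "w \<le> (\<Sum>j\<in>{int m - int n..int m - 1}. (2::real) powi j)"
    unfolding d by (intro sum_mono) auto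
  also have "\<dots> = 2 ^ m - 2 powi (int m - int n)"
  proof (induction n)
    case 0
    then show ?case by simp
  next
    case (Suc n)
    have "{int m - int (Suc n)..int m - 1} =
        insert (int m - int (Suc n)) {int m - int n..int m - 1}"
      by auto
    moreover have "(2::real) powi (int m - int n) = 2 * 2 powi (int m - int (Suc n))"
      using power_int_add_1'[of "2::real" "int m - int (Suc n)"] by simp
    ultimately show ?case
      using Suc.IH by simp
  qed
  also have "\<dots> < 2 ^ m"
    by simp
  finally show ?thesis .
qed

text \<open>Factor x - y as a difference of squares; the factor sqrt x + sqrt y is at least
  2.\<close>

lemma abs_sqrt_diff_le:
  assumes "1 \<le> x" "1 \<le> y"
  shows "\<bar>sqrt x - sqrt y\<bar> \<le> \<bar>x - y\<bar> / 2"
proof -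
  have "\<bar>x - y\<bar> = \<bar>(sqrt x - sqrt y) * (sqrt x + sqrt y)\<bar>"
    using assms by (simp add: algebra_simps)
  also have "\<dots> = \<bar>sqrt x - sqrt y\<bar> * (sqrt x + sqrt y)"
    using assms by (simp add: abs_mult)
  also have "\<dots> \<ge> \<bar>sqrt x - sqrt y\<bar> * 2"
    using real_sqrt_ge_one[OF assms(1)] real_sqrt_ge_one[OF assms(2)]
    by (intro mult_left_mono) linarith+
  finally show ?thesis
    by simp
qed

text \<open>The existential hides the change of input format after the first call. With the value w
  at index 0, all steps get the same shape and the induction can start there.\<close>

lemma pow2roots_Suc: "\<exists>n'. pow2roots w n m b (Suc i) = SQRT (pow2roots w n m b i) n' m b"
  by (cases i) auto

text \<open>With B the error bound of one call, an error E of the input becomes at most E / 2 + B,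
  and 2 B is the fixed point of this map. At index 0 the error is 0.\<close>

lemma pow2roots_bounds:
  assumes w: "1 \<le> w" "w < 2 ^ m" and b: "b \<ge> 2 * m" "b \<ge> 4"
  shows "1 \<le> pow2roots w n m b i \<and> pow2roots w n m b i < 2 ^ m \<and>
    \<bar>pow2roots w n m b i - w powr (1 / 2 ^ i)\<bar>
      \<le> 2 * ((3 / 4) ^ (b - 2 * m) * (2 + real b + log 2 (real b)))"
proof (induction i)
  case 0
  have "0 \<le> log 2 (real b)"
    using b by simp
  then show ?case
    using w by simp
next
  case (Suc i)
  let ?B = "(3 / 4) ^ (b - 2 * m) * (2 + real b + log 2 (real b))"
  define z where "z = pow2roots w n m b i"
  define v where "v = w powr (1 / 2 ^ i)"
  have z: "1 \<le> z" "z < 2 ^ m" "\<bar>z - v\<bar> \<le> 2 * ?B"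
    using Suc.IH unfolding z_def v_def by blast+
  obtain n' where step: "pow2roots w n m b (Suc i) = SQRT z n' m b"
    using pow2roots_Suc unfolding z_def by blast
  have "1 \<le> v"
    unfolding v_def using w by (simp add: ge_one_powr_ge_zero)
  then have "\<bar>sqrt z - sqrt v\<bar> \<le> ?B"
    using abs_sqrt_diff_le[OF z(1)] z(3) by fastforce
  moreover have "sqrt v = w powr (1 / 2 ^ Suc i)"
    using w by (simp add: v_def powr_half_sqrt[symmetric] powr_powr mult.commute)
  ultimately have "\<bar>SQRT z n' m b - w powr (1 / 2 ^ Suc i)\<bar> \<le> 2 * ?B"
    using SQRT_bounds(3)[OF z(1,2) b, of n'] by linarith
  then show ?case
    unfolding step using SQRT_bounds(1,2)[OF z(1,2) b] by blast
qed

theorem theorem2: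
  fixes n m b k :: nat and w :: real
  assumes "b \<ge> max (2 * m) 4" and "k \<ge> 1"
    and "w > 1" and "fixed_repr n m w"
  shows "\<forall>i\<in>{1..k}. \<bar>pow2roots w n m b i - w powr (1 / 2 ^ i)\<bar>
           \<le> 2 * (3 / 4) ^ (b - 2 * m) * (2 + real b + log 2 (real b))"
  using pow2roots_bounds[OF _ fixed_repr_less[OF assms(4)], of b] assms(1,3)
  by (simp add: mult.assoc)

end
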